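(* Let $n\geq 3$ and let $(d_1,\dots,d_n)$ be a sequence of integers satisfying (i) $d_1\geq d_2\geq\cdots\geq d_n\geq 4$; (ii) $\sum_{i=1}^n d_i$ is even; (iii) $d_1\leq \sum_{i=2}^n (d_i-1)$. Then there exists a triangular multigraph $G$ on vertices $v_1,\dots,v_n$ with $\deg(v_i)=d_i$ for all $i\in\{1,\dots,n\}$.
   Context: A multigraph is a finite graph in which multiple edges between the same pair of vertices are allowed; the degree of a vertex is the number of edges incident to it, counted with multiplicity. A triangle in a multigraph consists of three distinct vertices which are pairwise adjacent. A multigraph is triangular if every edge is contained in a triangle. A sequence $(d_1,\dots,d_n)$ is the degree sequence of a multigraph if the multigraph has vertices $v_1,\dots,v_n$ with $\deg(v_i)=d_i$ for all $i$. *)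

theory Defs
  imports "HOL-Library.Multiset"
begin

text \<open>
  An edge is represented by the two-element set of its ends, and parallel edges by the multiplicity
  of that set. In particular there are no loops.
\<close>

record 'v multigraph =
  verts :: "'v set"
  edges :: "'v set multiset"

definition is_multigraph :: "'v multigraph \<Rightarrow> bool" where
  "is_multigraph G \<longleftrightarrow>
     finite (verts G) \<and> (\<forall>e. e \<in># edges G \<longrightarrow> e \<subseteq> verts G \<and> card e = 2)"

definition degree :: "'v multigraph \<Rightarrow> 'v \<Rightarrow> nat" where
  "degree G v = size {#e \<in># edges G. v \<in> e#}"

definition adjacent :: "'v multigraph \<Rightarrow> 'v \<Rightarrow> 'v \<Rightarrow> bool" where
  "adjacent G u v \<longleftrightarrow> u \<noteq> v \<and> {u, v} \<in># edges G"

definition is_triangle :: "'v multigraph \<Rightarrow> 'v set \<Rightarrow> bool" where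
  "is_triangle G T \<longleftrightarrow>
     T \<subseteq> verts G \<and> card T = 3 \<and> (\<forall>u\<in>T. \<forall>v\<in>T. u \<noteq> v \<longrightarrow> adjacent G u v)"

definition triangular :: "'v multigraph \<Rightarrow> bool" where
  "triangular G \<longleftrightarrow> (\<forall>e. e \<in># edges G \<longrightarrow> (\<exists>T. is_triangle G T \<and> e \<subseteq> T))"

end

theory Submission
  imports Defs
begin

text \<open>
  Let \<open>h\<close> be a vertex of maximum degree. If \<open>d h \<ge> n - 1\<close>, join \<open>h\<close> to every other vertex and put
  a loopless multigraph without isolated vertices on the remaining ones: each of its edges forms a
  triangle with \<open>h\<close>. Its degrees \<open>f w\<close> have to satisfy \<open>1 \<le> f w \<le> d w - 1\<close>, they must sum to
  \<open>(\<Sum>w\<noteq>h. d w) - d h\<close>, and none may exceed half of that sum; condition (iii) says precisely that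
  the lower bounds are compatible with the sum. If \<open>d h \<le> n - 2\<close>, split the vertices into two parts
  of about equal size, both of even degree sum. Condition (iii) then holds in both parts because all
  degrees are at least 4, and the disjoint union of two smaller realizations works.
\<close>

section \<open>Integer interpolation and loopless degree sequences\<close>

lemma obtain_max_on:
  fixes f :: "'a \<Rightarrow> 'b::linorder"
  assumes "finite A" and "A \<noteq> {}"
  obtains x where "x \<in> A" and "\<And>y. y \<in> A \<Longrightarrow> f y \<le> f x"
proof -
  have "Max (f ` A) \<in> f ` A"
    using assms by simp
  then obtain x where "x \<in> A" "f x = Max (f ` A)"
    by auto
  then show thesis
    using assms by (intro that[of x]) auto
qed

lemma sum_interpolation:
  fixes l u :: "'a \<Rightarrow> nat"
  assumes "finite W" and "\<And>w. w \<in> W \<Longrightarrow> l w \<le> u w" and "sum l W \<le> s" and "s \<le> sum u W"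
  shows "\<exists>f. (\<forall>w\<in>W. l w \<le> f w \<and> f w \<le> u w) \<and> sum f W = s"
  using assms
proof (induction W arbitrary: s rule: finite_induct)
  case empty
  then show ?case by simp
next
  case (insert x F)
  \<comment> \<open>\<open>t\<close> is the least total that \<open>F\<close> can take: it must meet
    the lower bounds on \<open>F\<close> and absorb whatever exceeds \<open>u x\<close>. Truncated
    subtraction covers the case \<open>s < u x\<close>.\<close>
  define t where "t = max (sum l F) (s - u x)"
  have lu: "sum l F \<le> sum u F"
    using insert.prems(1) by (intro sum_mono) auto
  have "l x \<le> u x"
    using insert.prems(1) by simp
  then have t: "sum l F \<le> t" "t \<le> sum u F" "l x \<le> s - t" "s - t \<le> u x" "t \<le> s"
    using insert.prems(2,3) insert.hyps lu by (auto simp: t_def)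
  obtain f where f: "\<forall>w\<in>F. l w \<le> f w \<and> f w \<le> u w" "sum f F = t"
    using insert.IH[OF _ t(1,2)] insert.prems(1) by auto
  have "sum (f(x := s - t)) F = t"
    using f(2) insert.hyps by (metis (no_types, lifting) fun_upd_other sum.cong)
  then have "sum (f(x := s - t)) (insert x F) = s"
    using insert.hyps t(5) by simp
  moreover have "\<forall>w\<in>insert x F. l w \<le> (f(x := s - t)) w \<and> (f(x := s - t)) w \<le> u w"
    using f(1) t(3,4) by auto
  ultimately show ?case by blast
qed

text \<open>Repeatedly join two vertices of largest remaining degree.\<close>

lemma loopless_degree_sequence:
  fixes f :: "'v \<Rightarrow> nat"
  assumes "finite W" and "even (sum f W)" and "\<And>w. w \<in> W \<Longrightarrow> 2 * f w \<le> sum f W"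
  shows "\<exists>E. (\<forall>e. e \<in># E \<longrightarrow> e \<subseteq> W \<and> card e = 2) \<and> (\<forall>w\<in>W. size {#e \<in># E. w \<in> e#} = f w)"
  using assms(2,3)
proof (induction "sum f W" arbitrary: f rule: less_induct)
  case less
  show ?case
  proof (cases "sum f W = 0")
    case True
    then show ?thesis
      using assms(1) by (intro exI[of _ "{#}"]) auto
  next
    case False
    then have "W \<noteq> {}" by auto
    then obtain x where x: "x \<in> W" "\<And>w. w \<in> W \<Longrightarrow> f w \<le> f x"
      using obtain_max_on[OF assms(1)] by metis
    have sx: "sum f W = f x + sum f (W - {x})"
      using assms(1) x(1) by (simp add: sum.remove)
    have fx: "f x \<noteq> 0"
    proof
      assume "f x = 0"
      then have "\<forall>w\<in>W. f w = 0"
        using x(2) by fastforce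
      then show False
        using False by simp
    qed
    \<comment> \<open>The bound at \<open>x\<close> says that the other vertices together carry at
      least \<open>f x > 0\<close>, so a second vertex \<open>y\<close> with \<open>f y > 0\<close>
      exists.\<close>
    have "W - {x} \<noteq> {}"
    proof
      assume "W - {x} = {}"
      then have "sum f (W - {x}) = 0"
        by (simp only: sum.empty)
      then show False
        using sx less.prems(2)[OF x(1)] fx by simp
    qed
    then obtain y where y: "y \<in> W - {x}" "\<And>w. w \<in> W - {x} \<Longrightarrow> f w \<le> f y"
      using obtain_max_on[of "W - {x}" f] assms(1) by (metis finite_Diff)
    have sy: "sum f W = f x + f y + sum f (W - {x, y})"
      using assms(1) y(1) sx by (metis (no_types, lifting) Diff_insert2 add.assoc finite_Diff sum.remove)
    have fy: "f y \<noteq> 0"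
    proof
      assume "f y = 0"
      then have "sum f (W - {x}) = 0"
        using y(2) by simp
      then show False
        using sx less.prems(2)[OF x(1)] fx by simp
    qed
    define g where "g = f(x := f x - 1, y := f y - 1)"
    have "sum g (W - {x, y}) = sum f (W - {x, y})"
      by (intro sum.cong) (auto simp: g_def)
    moreover have "sum g W = g x + g y + sum g (W - {x, y})"
      using assms(1) x(1) y(1)
      by (metis (no_types, lifting) Diff_insert2 add.assoc finite_Diff sum.remove)
    ultimately have sg: "sum f W = sum g W + 2"
      using sy fx fy y(1) by (simp add: g_def)
    have "2 * g w \<le> sum g W" if w: "w \<in> W" for w
    proof (cases "w = x \<or> w = y")
      case True
      then show ?thesis
        using less.prems(2)[OF w] sg y(1) by (auto simp: g_def)
    \<comment> \<open>For any other \<open>w\<close>, each of \<open>f x\<close>, \<open>f y\<close>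
      and the remaining sum is at least \<open>f w\<close>, so \<open>3 * f w\<close> is at most the
      positive even sum \<open>2 * k\<close>. Hence \<open>f w < k\<close>, and the bound survives
      lowering the sum by 2.\<close>
    next
      case False
      then have "f w \<le> sum f (W - {x, y})"
        using w assms(1) by (intro member_le_sum) auto
      moreover have "f w \<le> f y" "f y \<le> f x" "g w = f w"
        using w False y x by (auto simp: g_def)
      ultimately have "3 * f w \<le> sum f W" "2 \<le> sum f W" "g w = f w"
        using sy fx fy by auto
      moreover obtain k where "sum f W = 2 * k"
        using less.prems(1) by (elim evenE)
      ultimately show ?thesis
        using sg by presburger
    qed
    then obtain E where E: "\<forall>e. e \<in># E \<longrightarrow> e \<subseteq> W \<and> card e = 2"
        "\<forall>w\<in>W. size {#e \<in># E. w \<in> e#} = g w"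
      using less.hyps[of g] sg less.prems(1) by fastforce
    have "\<forall>w\<in>W. size {#e \<in># add_mset {x, y} E. w \<in> e#} = f w"
      using E(2) fx fy by (auto simp: g_def)
    moreover have "\<forall>e. e \<in># add_mset {x, y} E \<longrightarrow> e \<subseteq> W \<and> card e = 2"
      using E(1) x(1) y(1) by auto
    ultimately show ?thesis by blast
  qed
qed

section \<open>Triangular realizations: disjoint unions and the hub construction\<close>

definition triangular_realization :: "'v set \<Rightarrow> ('v \<Rightarrow> nat) \<Rightarrow> 'v multigraph \<Rightarrow> bool" where
  "triangular_realization V d G \<longleftrightarrow>
     is_multigraph G \<and> verts G = V \<and> triangular G \<and> (\<forall>x\<in>V. degree G x = d x)"

lemma triangular_realization_disjoint_union:
  assumes A: "triangular_realization A d G" and B: "triangular_realization B d H"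
    and disj: "A \<inter> B = {}"
  shows "triangular_realization (A \<union> B) d \<lparr>verts = A \<union> B, edges = edges G + edges H\<rparr>"
    (is "triangular_realization _ _ ?U")
proof -
  have zero: "degree G x = 0" if "x \<in> B" for x
    using A disj that by (auto simp: triangular_realization_def is_multigraph_def degree_def filter_mset_eq_conv)
  have zero': "degree H x = 0" if "x \<in> A" for x
    using B disj that by (auto simp: triangular_realization_def is_multigraph_def degree_def filter_mset_eq_conv)
  have deg: "degree ?U x = degree G x + degree H x" for x
    by (simp add: degree_def)
  have "is_triangle ?U T" if "is_triangle G T \<or> is_triangle H T" for T
    using that A B by (auto simp: is_triangle_def adjacent_def triangular_realization_def)
  then have "triangular ?U"
    using A B unfolding triangular_def triangular_realization_def
    by (metis multigraph.select_convs(2) union_iff)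
  then show ?thesis
    using A B zero zero' deg
    by (auto simp: triangular_realization_def is_multigraph_def)
qed

lemma size_filter_mset_sum:
  "finite W \<Longrightarrow> size {#e \<in># (\<Sum>w\<in>W. M w). P e#} = (\<Sum>w\<in>W. size {#e \<in># M w. P e#})"
  by (induction W rule: finite_induct) auto

lemma size_filter_mset_replicate:
  "size {#e \<in># replicate_mset k a. P e#} = (if P a then k else 0)"
  by (induction k) auto

text \<open>With \<open>s = sum d W - d h\<close> as the degree sum left for the edges inside
  \<open>W\<close>, \<open>small\<close> says that lower bounds 1 fit under \<open>s\<close>, and
  \<open>large\<close> says that the upper bounds \<open>d w - 1\<close> reach
  \<open>s\<close>.\<close>

lemma triangular_realization_hub:
  fixes d :: "'v \<Rightarrow> nat"
  assumes fin: "finite W" and h: "h \<notin> W" and card: "2 \<le> card W"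
    and two: "\<And>w. w \<in> W \<Longrightarrow> 2 \<le> d w" and max: "\<And>w. w \<in> W \<Longrightarrow> d w \<le> d h"
    and even: "even (d h + sum d W)" and large: "card W \<le> d h"
    and small: "d h + card W \<le> sum d W"
  shows "\<exists>G. triangular_realization (insert h W) d G"
proof -
  define s where "s = sum d W - d h"
  have s: "sum d W = s + d h" "even s" "card W \<le> s"
    using small even by (auto simp: s_def)
  define r where "r = s div 2"
  have r: "s = 2 * r" "1 \<le> r"
    using s card by (auto simp: r_def)
  \<comment> \<open>The cap \<open>r\<close>, half of the prescribed sum, is what a loopless
    multigraph requires.\<close>
  define u where "u w = min (d w - 1) r" for w
  have u1: "1 \<le> u w" if "w \<in> W" for w
    using two[OF that] r by (auto simp: u_def)
  have "s \<le> sum u W"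
  \<comment> \<open>The cases count the vertices where the cap \<open>r\<close> bites. If none,
    \<open>large\<close> suffices; if two, they alone contribute \<open>2 * r = s\<close>. If only
    \<open>x\<close>, every other \<open>w\<close> has \<open>d w \<le> 2 * u w\<close>, so the
    others contribute at least half of \<open>sum d W - d x\<close>, which is at least
    \<open>r\<close> because \<open>d x \<le> d h\<close>.\<close>
  proof (cases "\<exists>x\<in>W. r < d x - 1")
    case False
    then have "sum u W = (\<Sum>w\<in>W. d w - 1)"
      by (intro sum.cong) (auto simp: u_def)
    also have "\<dots> = sum d W - card W"
      using two by (subst sum_subtractf_nat) force+
    finally show ?thesis
      using s large by linarith
  next
    case True
    then obtain x where x: "x \<in> W" "r < d x - 1" by blast
    then have ux: "u x = r" by (simp add: u_def)
    have sumd: "sum d W = d x + sum d (W - {x})" and sumu: "sum u W = r + sum u (W - {x})"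
      using fin x ux by (simp_all add: sum.remove)
    show ?thesis
    proof (cases "\<exists>y\<in>W - {x}. r < d y - 1")
      case True
      then obtain y where y: "y \<in> W - {x}" "r < d y - 1" by blast
      then have "u y \<le> sum u (W - {x})"
        using fin by (intro member_le_sum) auto
      then show ?thesis
        using sumu y r by (simp add: u_def)
    next
      case False
      then have "d w \<le> 2 * u w" if "w \<in> W - {x}" for w
        using that two[of w] by (force simp: u_def)
      then have "sum d (W - {x}) \<le> (\<Sum>w\<in>W - {x}. 2 * u w)"
        by (intro sum_mono)
      then show ?thesis
        using sumd sumu s r max[OF x(1)] by (simp add: sum_distrib_left[symmetric])
    qed
  qed
  then obtain f where f: "\<forall>w\<in>W. 1 \<le> f w \<and> f w \<le> u w" "sum f W = s"
    using sum_interpolation[OF fin, of "\<lambda>_. 1" u s] u1 s by auto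
  have fr: "f w \<le> r" "f w \<le> d w - 1" if "w \<in> W" for w
    using f(1) that by (auto simp: u_def)
  obtain F where F: "\<forall>e. e \<in># F \<longrightarrow> e \<subseteq> W \<and> card e = 2"
      "\<forall>w\<in>W. size {#e \<in># F. w \<in> e#} = f w"
    using loopless_degree_sequence[OF fin, of f] f(2) s r fr by auto
  \<comment> \<open>The multiplicities fill each \<open>w\<close> up to \<open>d w\<close> and give
    \<open>h\<close> the degree \<open>sum d W - s = d h\<close>. They are positive, so
    \<open>h\<close> is adjacent to all of \<open>W\<close>.\<close>
  define S where "S = (\<Sum>w\<in>W. replicate_mset (d w - f w) {h, w})"
  define G where "G = \<lparr>verts = insert h W, edges = F + S\<rparr>"
  have S_iff: "e \<in># S \<longleftrightarrow> (\<exists>w\<in>W. e = {h, w})" for e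
  proof -
    have "d w - f w \<noteq> 0" if "w \<in> W" for w
      using fr(2)[OF that] two[OF that] by linarith
    then show ?thesis
      using fin by (auto simp: S_def set_mset_sum)
  qed
  have "is_multigraph G"
    using fin h F(1) by (auto simp: is_multigraph_def G_def S_iff card_insert_if)
  moreover have "degree G x = d x" if "x \<in> insert h W" for x
  proof (cases "x = h")
    case True
    have "{#e \<in># F. h \<in> e#} = {#}"
      using F(1) h by (auto simp: filter_mset_eq_conv)
    moreover have "size {#e \<in># S. h \<in> e#} = (\<Sum>w\<in>W. d w - f w)"
      by (simp add: S_def fin size_filter_mset_sum size_filter_mset_replicate)
    moreover have "(\<Sum>w\<in>W. d w - f w) = sum d W - sum f W"
      using fr(2) two by (intro sum_subtractf_nat) force
    ultimately show ?thesis
      using True s f(2) by (simp add: degree_def G_def)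
  next
    case False
    then have x: "x \<in> W" using that by simp
    have "size {#e \<in># S. x \<in> e#} = (\<Sum>w\<in>W. if x = w then d w - f w else 0)"
      using False by (simp add: S_def fin size_filter_mset_sum size_filter_mset_replicate)
    then have "size {#e \<in># S. x \<in> e#} = d x - f x"
      using fin x by simp
    then show ?thesis
      using F(2) x fr(2)[OF x] by (simp add: degree_def G_def)
  qed
  moreover have "triangular G"
  proof -
    have tri: "is_triangle G (insert h e)" if "e \<in># F" for e
    proof -
      have "card e = 2"
        using F(1) that by blast
      then obtain a b where ab: "e = {a, b}" "a \<noteq> b"
        by (auto simp: card_2_iff)
      have W: "a \<in> W" "b \<in> W"
        using F(1) that ab by auto
      then have ne: "h \<noteq> a" "h \<noteq> b"
        using h by auto
      have sym: "adjacent G y x" if "adjacent G x y" for x y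
        using that by (auto simp: adjacent_def insert_commute)
      have "adjacent G a b" "adjacent G h a" "adjacent G h b"
        using ab W ne \<open>e \<in># F\<close> unfolding adjacent_def G_def by (simp_all add: S_iff) blast+
      then have "\<forall>x\<in>{h, a, b}. \<forall>y\<in>{h, a, b}. x \<noteq> y \<longrightarrow> adjacent G x y"
        using sym by blast
      moreover have "card {h, a, b} = 3"
        using ab ne by simp
      moreover have "{h, a, b} \<subseteq> verts G"
        using W by (simp add: G_def)
      ultimately show ?thesis
        unfolding is_triangle_def ab(1) by blast
    qed
    show ?thesis
      unfolding triangular_def
    proof (intro allI impI)
      fix e assume "e \<in># edges G"
      then consider "e \<in># F" | w where "w \<in> W" "e = {h, w}"
        by (auto simp: G_def S_iff)
      then show "\<exists>T. is_triangle G T \<and> e \<subseteq> T"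
      proof cases
        case 1
        then show ?thesis using tri by blast
      next
        case 2
        \<comment> \<open>Since \<open>f w \<ge> 1\<close>, some edge of \<open>F\<close> meets
          \<open>w\<close>; its triangle with \<open>h\<close> also contains
          \<open>{h, w}\<close>.\<close>
        then have "{#e \<in># F. w \<in> e#} \<noteq> {#}"
          using F(2) f(1) by (metis not_one_le_zero size_empty)
        then obtain e' where "e' \<in># F" "w \<in> e'"
          by (auto simp: filter_mset_eq_conv)
        then show ?thesis using tri 2 by blast
      qed
    qed
  qed
  ultimately show ?thesis
    by (auto simp: triangular_realization_def G_def)
qed

section \<open>Splitting the vertex set and induction on its size\<close>

text \<open>Odd values are selected first, so an even number of them is selected.\<close>

lemma even_sum_subset:
  fixes d :: "'a \<Rightarrow> nat"
  assumes fin: "finite V" and even: "even (sum d V)" and "even k" and "k \<le> card V"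
  shows "\<exists>A\<subseteq>V. card A = k \<and> even (sum d A)"
proof -
  define D where "D = {x \<in> V. odd (d x)}"
  have D: "D \<subseteq> V" "finite D" "even (card D)"
    using fin even by (auto simp: D_def even_sum_iff)
  have ev: "even (sum d A) \<longleftrightarrow> even (card (A \<inter> D))" if "A \<subseteq> V" for A
  proof -
    have "{x \<in> A. odd (d x)} = A \<inter> D"
      using that by (auto simp: D_def)
    then show ?thesis
      using that fin by (simp add: even_sum_iff finite_subset)
  qed
  show ?thesis
  \<comment> \<open>Either all \<open>k\<close> chosen values are odd, or all of \<open>D\<close> is
    chosen and filled up with even values; \<open>card D\<close> is even because the total
    is.\<close>
  proof (cases "k \<le> card D")
    case True
    then obtain A where A: "A \<subseteq> D" "card A = k"
      by (meson obtain_subset_with_card_n)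
    then have "A \<inter> D = A" by blast
    then show ?thesis
      using A D(1) ev[of A] \<open>even k\<close> by auto
  next
    case False
    have "card (V - D) = card V - card D"
      using D by (simp add: card_Diff_subset)
    then obtain B where B: "B \<subseteq> V - D" "card B = k - card D"
      using \<open>k \<le> card V\<close> by (metis diff_le_mono obtain_subset_with_card_n)
    then have "card (D \<union> B) = k"
      using D False fin by (subst card_Un_disjoint) (auto intro: finite_subset)
    moreover have "(D \<union> B) \<inter> D = D" by blast
    ultimately show ?thesis
      using ev[of "D \<union> B"] D B by (intro exI[of _ "D \<union> B"]) auto
  qed
qed

text \<open>The last assumption is condition (iii), cleared of subtractions and demanded at every
  vertex. In this form it needs no ordering and can be checked directly on a subset.\<close>

lemma triangular_realization_exists:
  fixes d :: "'v \<Rightarrow> nat"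
  assumes "finite V" and "3 \<le> card V" and "\<And>x. x \<in> V \<Longrightarrow> 4 \<le> d x" and "even (sum d V)"
    and "\<And>x. x \<in> V \<Longrightarrow> 2 * d x + card V \<le> sum d V + 1"
  shows "\<exists>G. triangular_realization V d G"
  using assms
proof (induction "card V" arbitrary: V rule: less_induct)
  case less
  note fin = less.prems(1)
  have "V \<noteq> {}" using less.prems(2) by auto
  then obtain h where h: "h \<in> V" "\<And>w. w \<in> V \<Longrightarrow> d w \<le> d h"
    using obtain_max_on[OF fin] by metis
  define n where "n = card V"
  have sum_h: "sum d V = d h + sum d (V - {h})"
    using fin h(1) by (simp add: sum.remove)
  have card_h: "card (V - {h}) = n - 1"
    using fin h(1) by (simp add: n_def)
  show ?case
  proof (cases "n - 1 \<le> d h")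
    case True
    have "\<exists>G. triangular_realization (insert h (V - {h})) d G"
    proof (rule triangular_realization_hub)
      show "2 \<le> d w" if "w \<in> V - {h}" for w
        using less.prems(3)[of w] that by simp
      show "d h + card (V - {h}) \<le> sum d (V - {h})"
        using less.prems(5)[OF h(1)] sum_h card_h less.prems(2) by (simp add: n_def)
    qed (use fin less.prems sum_h card_h True h in \<open>auto simp: n_def\<close>)
    then show ?thesis
      using h(1) by (simp add: insert_absorb)
  next
    case False
    then have dn: "d x \<le> n - 2" if "x \<in> V" for x
      using h(2)[OF that] by linarith
    have n6: "6 \<le> n"
      using less.prems(3)[OF h(1)] dn[OF h(1)] by linarith
    \<comment> \<open>As all degrees are at least 4, condition (iii) at \<open>x\<close> in
      \<open>A\<close> follows from \<open>d x + 3 \<le> 3 * card A\<close>. Since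
      \<open>d x \<le> n - 2\<close>, the bound \<open>n + 1 \<le> 3 * card A\<close> is
      enough.\<close>
    have part: "\<exists>G. triangular_realization A d G"
      if A: "A \<subseteq> V" "3 \<le> card A" "card A < n" "n + 1 \<le> 3 * card A" "even (sum d A)" for A
    proof (rule less.hyps)
      have finA: "finite A" using A(1) fin by (rule finite_subset)
      show "2 * d x + card A \<le> sum d A + 1" if x: "x \<in> A" for x
      proof -
        have "4 * card (A - {x}) \<le> sum d (A - {x})"
          using sum_bounded_below[of "A - {x}" 4 d] less.prems(3) A(1) by (auto simp: mult.commute)
        then show ?thesis
          using x finA dn[of x] A by (auto simp: sum.remove)
      qed
    qed (use A fin less.prems in \<open>auto simp: n_def intro: finite_subset\<close>)
    have "\<exists>A\<subseteq>V. even (sum d A) \<and> 3 \<le> card A \<and> 3 \<le> n - card A \<and> n + 1 \<le> 3 * card A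
            \<and> n + 1 \<le> 3 * (n - card A)"
    \<comment> \<open>For \<open>n = 6\<close> both parts must have the odd size 3, which the parity
      selection does not cover; but then all degrees equal 4 and any halving works.\<close>
    proof (cases "n = 6")
      case True
      have d4: "d x = 4" if "x \<in> V" for x
        using dn[OF that] less.prems(3)[OF that] True by simp
      obtain A where A: "A \<subseteq> V" "card A = 3"
        using obtain_subset_with_card_n[of 3 V] less.prems(2) by auto
      have "sum d A = (\<Sum>x\<in>A. 4)"
        using d4 A(1) by (intro sum.cong) auto
      then show ?thesis
        using A True by (intro exI[of _ A]) auto
    next
      case False
      \<comment> \<open>\<open>k\<close> is the largest even number not exceeding
        \<open>(n + 1) / 2\<close>. From \<open>n \<ge> 7\<close> comes \<open>m \<ge> 2\<close>,
        which makes both parts large enough.\<close>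
      define m where "m = (n + 1) div 4"
      define k where "k = 2 * m"
      have "2 \<le> m" "4 * m \<le> n + 1" "n + 1 \<le> 4 * m + 3"
        using False n6 by (auto simp: m_def)
      then have k: "k \<le> card V" "3 \<le> k" "3 \<le> n - k" "n + 1 \<le> 3 * k" "n + 1 \<le> 3 * (n - k)"
        unfolding k_def n_def[symmetric] by linarith+
      obtain A where "A \<subseteq> V" "card A = k" "even (sum d A)"
        using even_sum_subset[OF fin less.prems(4) _ k(1)] by (auto simp: k_def)
      then show ?thesis
        using k by (intro exI[of _ A]) auto
    qed
    then obtain A where A: "A \<subseteq> V" "even (sum d A)" "3 \<le> card A" "3 \<le> n - card A"
        "n + 1 \<le> 3 * card A" "n + 1 \<le> 3 * (n - card A)"
      by blast
    have finA: "finite A" using A(1) fin by (rule finite_subset)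
    have B: "card (V - A) = n - card A" "sum d V = sum d A + sum d (V - A)"
      using A(1) fin finA by (auto simp: card_Diff_subset n_def sum.subset_diff)
    have "card A < n" "card (V - A) < n"
      using A(3,4) B(1) by linarith+
    obtain G where "triangular_realization A d G"
      using part[of A] A \<open>card A < n\<close> by auto
    moreover obtain H where "triangular_realization (V - A) d H"
      using part[of "V - A"] A B \<open>card (V - A) < n\<close> less.prems(4) by auto
    ultimately have "\<exists>U. triangular_realization (A \<union> (V - A)) d U"
      using triangular_realization_disjoint_union by (metis Diff_disjoint)
    then show ?thesis
      using A(1) by (simp add: Un_absorb1)
  qed
qed

section \<open>Transfer to indexed integer sequences\<close>

theorem theorem1p5:
  fixes n :: nat and d :: "nat \<Rightarrow> int" and v :: "nat \<Rightarrow> 'v"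
  assumes "n \<ge> 3"
    and "inj_on v {1..n}"
    and "\<forall>i\<in>{1..<n}. d i \<ge> d (i + 1)" and "d n \<ge> 4"
    and "even (\<Sum>i=1..n. d i)"
    and "d 1 \<le> (\<Sum>i=2..n. (d i - 1))"
  shows "\<exists>G :: 'v multigraph. is_multigraph G \<and> verts G = v ` {1..n} \<and> triangular G \<and>
           (\<forall>i\<in>{1..n}. int (degree G (v i)) = d i)"
proof -
  have anti: "d j \<le> d i" if "i \<le> j" "1 \<le> i" "j \<le> n" for i j
    using that
  proof (induction j rule: dec_induct)
    case base
    then show ?case by simp
  next
    case (step j)
    then have "d (Suc j) \<le> d j"
      using assms(3) by auto
    with step show ?case by simp
  qed
  \<comment> \<open>Degrees become a function of the vertex. Applying \<open>nat\<close> loses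
    nothing, since \<open>d i \<ge> d n \<ge> 4\<close>.\<close>
  define e where "e x = nat (d (inv_into {1..n} v x))" for x
  have e: "int (e (v i)) = d i" if "i \<in> {1..n}" for i
    using that anti[of i n] assms(2,4) by (simp add: e_def)
  have sum_e: "int (sum e (v ` {1..n})) = (\<Sum>i=1..n. d i)"
    using assms(2) e by (simp add: sum.reindex)
  have card: "card (v ` {1..n}) = n"
    using assms(2) by (simp add: card_image)
  have "{1..n} = insert 1 {2..n}"
    using assms(1) by auto
  then have "(\<Sum>i=1..n. d i) = d 1 + (\<Sum>i=2..n. d i)"
    by simp
  \<comment> \<open>Adding \<open>d 1\<close> to both sides of (iii) completes the sum; its
    \<open>n - 1\<close> subtracted ones account for \<open>int n\<close> and the
    \<open>+ 1\<close>. As \<open>d 1\<close> is the maximum, the bound passes to every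
    vertex.\<close>
  then have sum_ge: "2 * d 1 + int n \<le> (\<Sum>i=1..n. d i) + 1"
    using assms(1,6) by (simp add: sum_subtractf)
  have "\<exists>G. triangular_realization (v ` {1..n}) e G"
  proof (rule triangular_realization_exists)
    show "4 \<le> e x" if "x \<in> v ` {1..n}" for x
      using that e anti[of _ n] assms(4) by fastforce
    show "even (sum e (v ` {1..n}))"
      using sum_e assms(5) by (metis even_of_nat)
    show "2 * e x + card (v ` {1..n}) \<le> sum e (v ` {1..n}) + 1" if x: "x \<in> v ` {1..n}" for x
    proof -
      obtain i where i: "i \<in> {1..n}" "x = v i" using x by blast
      then have "2 * int (e x) + int n \<le> int (sum e (v ` {1..n})) + 1"
        using e[OF i(1)] anti[of 1 i] sum_ge sum_e by simp
      then show ?thesis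
        unfolding card by linarith
    qed
  qed (use assms(1) card in auto)
  then show ?thesis
    using e by (auto simp: triangular_realization_def)
qed

end
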